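(* Let $K=2$ and let $\nu_1,\nu_2$ be sub-Gaussian reward distributions with means $\mu^{(1)},\mu^{(2)}$ such that $\mu^{(\star)}=\max(\mu^{(1)},\mu^{(2)})=0$ and $\min(\mu^{(1)},\mu^{(2)})=-\Delta$ with $\Delta>0$. Then the two-armed policy described in the context (which uses the knowledge of $\mu^{(\star)}=0$ and of $\Delta$) satisfies, for every $n\ge 1$, $$R_n\le \Delta+\frac{16}{\Delta}.$$
   Context: Stochastic bandit: there are $K$ arms; successive pulls of arm $i\in\{1,\dots,K\}$ yield i.i.d. rewards $Y^{(i)}_1,Y^{(i)}_2,\dots$ with distribution $\nu_i$ and mean $\mu^{(i)}$, independently across arms. A distribution $\nu_i$ with mean $\mu^{(i)}$ is called sub-Gaussian here if $\int e^{\lambda(x-\mu^{(i)})}\nu_i(dx)\le e^{\lambda^2/2}$ for all $\lambda\in\mathbb{R}$. A policy is a sequence of random variables $I_t\in\{1,\dots,K\}$ (the arm pulled at time $t$), where $I_t$ depends only on observations strictly anterior to $t$. Let $\mu^{(\star)}=\max_i\mu^{(i)}$ and $\Delta_i=\mu^{(\star)}-\mu^{(i)}$. The regret at time $n$ is $R_n=n\mu^{(\star)}-\sum_{t=1}^n\mathbb{E}\,\mu^{(I_t)}=\sum_{i=1}^K\Delta_i\,\mathbb{E}\,T_i(n+1)$, where $T_i(t)=\sum_{\ell=1}^{t-1}\mathbf{1}\{I_\ell=i\}$ is the number of pulls of arm $i$ strictly before time $t$. For $s\ge1$, $\widehat\mu^{(i)}_s=\frac1s\sum_{\ell=1}^sY^{(i)}_\ell$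 is the empirical mean of arm $i$ after $s$ pulls. The two-armed policy: (0) At $t=1,2$, set $I_t=t$. Then, starting at $t=3$, repeat: (1) if for some $i\in\{1,2\}$, with $j$ the other arm, $\widehat\mu^{(i)}_{T_i(t)}>-\Delta/2$ and $\widehat\mu^{(i)}_{T_i(t)}>\widehat\mu^{(j)}_{T_j(t)}$, then $I_t=i$ (and move to time $t+1$); (2) otherwise select both arms, i.e. $I_t=1$ and $I_{t+1}=2$ (and move to time $t+2$). *)

theory Defs
  imports "HOL-Probability.Probability"
begin

definition mean :: "real measure \<Rightarrow> real" where
  "mean \<nu> = (LINT x|\<nu>. x)"

text \<open>The arms are \<open>1, \<dots>, K\<close>, and \<open>Y i s\<close> with \<open>s \<ge> 1\<close> is the reward of the \<open>s\<close>-th pull of arm \<open>i\<close>;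
  the values \<open>Y i 0\<close> play no role.\<close>

locale stochastic_bandit = prob_space M
  for M :: "'w measure" and K :: nat and \<nu> :: "nat \<Rightarrow> real measure"
    and Y :: "nat \<Rightarrow> nat \<Rightarrow> 'w \<Rightarrow> real" +
  assumes reward_distribution: "\<And>i. i \<in> {1..K} \<Longrightarrow> real_distribution (\<nu> i)"
    and reward_integrable: "\<And>i. i \<in> {1..K} \<Longrightarrow> integrable (\<nu> i) (\<lambda>x. x)"
    and reward_distr: "\<And>i s. i \<in> {1..K} \<Longrightarrow> 1 \<le> s \<Longrightarrow> distr M borel (Y i s) = \<nu> i"
    and reward_indep: "indep_vars (\<lambda>_. borel) (\<lambda>(i, s). Y i s) ({1..K} \<times> {1..})"

text \<open>The integral is taken in \<open>ennreal\<close>, since the Bochner integral of a non-integrable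
  function is 0 and would satisfy the bound vacuously.\<close>

definition sub_gaussian :: "real measure \<Rightarrow> bool" where
  "sub_gaussian \<nu> \<longleftrightarrow>
     (\<forall>l::real. (\<integral>\<^sup>+x. ennreal (exp (l * (x - mean \<nu>))) \<partial>\<nu>) \<le> ennreal (exp (l\<^sup>2 / 2)))"

text \<open>In \<open>regret M K \<nu> A n\<close>, the random variable \<open>A t\<close> is the arm pulled at time \<open>t \<ge> 1\<close>.\<close>

definition regret ::
  "'w measure \<Rightarrow> nat \<Rightarrow> (nat \<Rightarrow> real measure) \<Rightarrow> (nat \<Rightarrow> 'w \<Rightarrow> nat) \<Rightarrow> nat \<Rightarrow> real" where
  "regret M K \<nu> A n =
     real n * Max ((\<lambda>i. mean (\<nu> i)) ` {1..K}) - (\<Sum>t=1..n. (LINT w|M. mean (\<nu> (A t w))))"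

definition empirical_mean :: "(nat \<Rightarrow> nat \<Rightarrow> real) \<Rightarrow> nat \<Rightarrow> nat \<Rightarrow> real" where
  "empirical_mean y i s = (\<Sum>l=1..s. y i l) / real s"

text \<open>Below, \<open>y i s\<close> is a realisation of the rewards and \<open>h\<close> lists the arms pulled at times
  \<open>1, \<dots>, t - 1\<close>, so that \<open>count_list h i\<close> is the number of pulls of arm \<open>i\<close> strictly before
  time \<open>t\<close>.\<close>

definition leads ::
  "real \<Rightarrow> (nat \<Rightarrow> nat \<Rightarrow> real) \<Rightarrow> nat list \<Rightarrow> nat \<Rightarrow> nat \<Rightarrow> bool" where
  "leads \<Delta> y h i j \<longleftrightarrow>
     empirical_mean y i (count_list h i) > - \<Delta> / 2 \<and>
     empirical_mean y i (count_list h i) > empirical_mean y j (count_list h j)"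

text \<open>\<open>two_armed_history \<Delta> y k\<close> lists the arms pulled up to the end of the \<open>k\<close>-th pass through
  the loop of the policy; a pass takes one or two time steps.\<close>

primrec two_armed_history :: "real \<Rightarrow> (nat \<Rightarrow> nat \<Rightarrow> real) \<Rightarrow> nat \<Rightarrow> nat list" where
  "two_armed_history \<Delta> y 0 = [1, 2]"
| "two_armed_history \<Delta> y (Suc k) =
     (let h = two_armed_history \<Delta> y k in
      h @ (if leads \<Delta> y h 1 2 then [1] else if leads \<Delta> y h 2 1 then [2] else [1, 2]))"

text \<open>Each pass only appends to the list, and after \<open>t\<close> passes it has at least \<open>t + 2\<close> entries.
  Hence its entry for time \<open>t \<ge> 1\<close>, at list position \<open>t - 1\<close>, exists and is final.\<close>

definition two_armed_policy :: "real \<Rightarrow> (nat \<Rightarrow> nat \<Rightarrow> real) \<Rightarrow> nat \<Rightarrow> nat" where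
  "two_armed_policy \<Delta> y t = two_armed_history \<Delta> y t ! (t - 1)"

end

theory Submission
  imports Defs
begin

text \<open>Let \<open>a\<close> be the optimal and \<open>b\<close> the suboptimal arm. After the first pull of \<open>b\<close>, each further
  one can be charged to an index \<open>s\<close> at which the empirical mean of \<open>b\<close> exceeds \<open>- \<Delta> / 2\<close>, or to one
  at which that of \<open>a\<close> does not, each index being charged at most once. By the Chernoff bound either
  event has probability at most \<open>exp (- \<Delta>\<^sup>2 s / 8)\<close>, and these sum to at most \<open>8 / \<Delta>\<^sup>2\<close>. Hence
  \<open>b\<close> is pulled at most \<open>1 + 16 / \<Delta>\<^sup>2\<close> times in expectation.\<close>

text \<open>The geometric series is at most \<open>exp (- x) / (1 - exp (- x))\<close>, that is
  \<open>1 / (exp x - 1)\<close>, and \<open>exp x\<close> is at least \<open>1 + x\<close>.\<close>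

lemma sum_exp_neg_le:
  fixes x :: real
  assumes "x > 0"
  shows "(\<Sum>s=1..N. exp (- x * real s)) \<le> 1 / x"
proof -
  have r: "exp (- x) < 1" using assms by simp
  have "(\<Sum>s=1..N. exp (- x * real s)) = (\<Sum>s=1..N. exp (- x) ^ s)"
    by (intro sum.cong refl) (simp add: exp_of_nat_mult [symmetric] mult.commute)
  also have "\<dots> = (exp (- x) - exp (- x) ^ Suc N) / (1 - exp (- x))"
    using r by (cases "N = 0") (auto simp: sum_gp)
  also have "\<dots> \<le> exp (- x) / (1 - exp (- x))"
    using r by (intro divide_right_mono) auto
  also have "\<dots> \<le> 1 / x"
  proof -
    have "exp (- x) * (1 + x) \<le> exp (- x) * exp x"
      by (intro mult_left_mono exp_ge_add_one_self) auto
    then have "exp (- x) * x \<le> 1 - exp (- x)"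
      by (simp add: exp_minus_inverse algebra_simps flip: exp_add)
    then show ?thesis using r assms by (simp add: divide_simps mult.commute)
  qed
  finally show ?thesis .
qed

section \<open>Pull counts along a fixed realisation of the rewards\<close>

lemma count_list_eq_card: "count_list xs x = card {t \<in> {1..length xs}. xs ! (t - 1) = x}"
proof -
  have "{t \<in> {1..length xs}. xs ! (t - 1) = x} = Suc ` {t. t < length xs \<and> x = xs ! t}"
  proof (intro set_eqI iffI)
    fix t assume "t \<in> {t \<in> {1..length xs}. xs ! (t - 1) = x}"
    then show "t \<in> Suc ` {t. t < length xs \<and> x = xs ! t}"
      by (cases t) auto
  qed auto
  then show ?thesis
    by (simp add: count_list_eq_length_filter length_filter_conv_card card_image)
qed

lemma set_two_armed_history: "set (two_armed_history \<Delta> y k) = {1, 2}"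
  by (induction k) (auto simp: Let_def)

lemma length_two_armed_history: "k + 2 \<le> length (two_armed_history \<Delta> y k)"
  by (induction k) (auto simp: Let_def)

text \<open>A pass pulls each arm at most once. Every charged index lies strictly below a pull
  count, so after \<open>n\<close> passes it is at most \<open>n\<close>.\<close>

lemma count_list_two_armed_history_le:
  "count_list (two_armed_history \<Delta> y k) i \<le> k + 1"
  by (induction k) (auto simp: Let_def)

lemma two_armed_history_nth_add:
  assumes "t < length (two_armed_history \<Delta> y k)"
  shows "two_armed_history \<Delta> y (k + m) ! t = two_armed_history \<Delta> y k ! t
    \<and> t < length (two_armed_history \<Delta> y (k + m))"
  using assms by (induction m) (auto simp: Let_def nth_append)

text \<open>Later passes only append, so all times up to \<open>n\<close> can be read off one and
  the same list.\<close>

lemma two_armed_policy_eq_nth: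
  assumes "1 \<le> t" "t \<le> n"
  shows "two_armed_policy \<Delta> y t = two_armed_history \<Delta> y n ! (t - 1)"
  using two_armed_history_nth_add [of "t - 1" \<Delta> y t "n - t"]
    length_two_armed_history [of t \<Delta> y] assms
  by (simp add: two_armed_policy_def)

lemma two_armed_policy_in:
  assumes "1 \<le> t"
  shows "two_armed_policy \<Delta> y t \<in> {1, 2}"
proof -
  have "t - 1 < length (two_armed_history \<Delta> y t)"
    using length_two_armed_history [of t \<Delta> y] assms by simp
  from nth_mem [OF this] show ?thesis
    by (simp add: two_armed_policy_def set_two_armed_history)
qed

text \<open>Only an inequality: \<open>n\<close> passes overshoot time \<open>n\<close>, and the
  extra entries may contain further pulls of \<open>i\<close>.\<close>

lemma card_two_armed_policy_le:
  "card {t \<in> {1..n}. two_armed_policy \<Delta> y t = i} \<le> count_list (two_armed_history \<Delta> y n) i"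
  unfolding count_list_eq_card
  using length_two_armed_history [of n \<Delta> y]
  by (intro card_mono) (auto simp: two_armed_policy_eq_nth)

text \<open>A pass that pulls \<open>b\<close> starts with \<open>b\<close> above the threshold or with \<open>a\<close>, which is then
  pulled too, at most at the threshold. The pull moves the empirical mean that is to blame to a
  new index, so no index is charged twice.\<close>

lemma count_list_two_armed_history_charge:
  assumes "{a, b} = {1, 2}"
  shows "count_list (two_armed_history \<Delta> y k) b \<le> 1
    + card {s \<in> {1..<count_list (two_armed_history \<Delta> y k) b}. empirical_mean y b s > - \<Delta> / 2}
    + card {s \<in> {1..<count_list (two_armed_history \<Delta> y k) a}. empirical_mean y a s \<le> - \<Delta> / 2}"
proof (induction k)
  case 0
  from assms show ?case by auto
next
  case (Suc k)
  define h where "h = two_armed_history \<Delta> y k"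
  \<comment> \<open>The charged ranges start at 1, so a pull count enters as a new index only if it
    is positive; the initial pulls of both arms ensure this.\<close>
  have pos: "0 < count_list h i" if "i \<in> {1, 2}" for i
    using that set_two_armed_history [of \<Delta> y k] by (metis count_list_0_iff gr0I h_def)
  have step: "card {s \<in> {1..<Suc m}. P s} = card {s \<in> {1..<m}. P s} + of_bool (P m)"
    if "0 < m" for m :: nat and P
  proof -
    have "{s \<in> {1..<Suc m}. P s} = {s \<in> {1..<m}. P s} \<union> (if P m then {m} else {})"
      using that by (auto simp: less_Suc_eq)
    then show ?thesis by (auto simp: card_insert_if)
  qed
  have ab: "a = 1 \<and> b = 2 \<or> a = 2 \<and> b = 1" using assms by (auto simp: doubleton_eq_iff)
  have p: "0 < count_list h b" "0 < count_list h a" using pos ab by auto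
  let ?h' = "two_armed_history \<Delta> y (Suc k)"
  \<comment> \<open>The two \<open>leads\<close> conditions exclude each other, so the order in
    which a pass tests the arms is immaterial: an arm is skipped exactly when the other one
    leads.\<close>
  have "count_list ?h' b = count_list h b + of_bool (\<not> leads \<Delta> y h a b)"
      "count_list ?h' a = count_list h a + of_bool (\<not> leads \<Delta> y h b a)"
    using ab by (auto simp: Let_def leads_def simp flip: h_def)
  \<comment> \<open>If \<open>b\<close> is at most at the threshold, \<open>a\<close> above it would
    lead. So \<open>a\<close> is at most at it too, and \<open>b\<close> cannot lead either: both
    arms are pulled and the count of \<open>a\<close> advances.\<close>
  moreover have "empirical_mean y b (count_list h b) > - \<Delta> / 2
      \<or> empirical_mean y a (count_list h a) \<le> - \<Delta> / 2 \<and> \<not> leads \<Delta> y h b a"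
    if "\<not> leads \<Delta> y h a b"
    using that by (auto simp: leads_def)
  ultimately show ?case
    using Suc.IH [folded h_def] step [OF p(1), of "\<lambda>s. empirical_mean y b s > - \<Delta> / 2"]
      step [OF p(2), of "\<lambda>s. empirical_mean y a s \<le> - \<Delta> / 2"]
    by (cases "leads \<Delta> y h a b"; cases "leads \<Delta> y h b a") (auto simp del: two_armed_history.simps)
qed

section \<open>Measurability of the policy and concentration of the empirical means\<close>

context stochastic_bandit
begin

lemma measurable_reward:
  assumes "i \<in> {1..K}" "1 \<le> s"
  shows "Y i s \<in> borel_measurable M"
  using assms reward_indep unfolding indep_vars_def2 by auto

lemma measurable_empirical_mean:
  assumes "i \<in> {1..K}"
  shows "(\<lambda>w. empirical_mean (\<lambda>i s. Y i s w) i s) \<in> borel_measurable M"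
  unfolding empirical_mean_def using assms
  by (intro borel_measurable_divide borel_measurable_sum measurable_reward) auto

lemma measurable_two_armed_history:
  assumes "2 \<le> K"
  shows "(\<lambda>w. two_armed_history \<Delta> (\<lambda>i s. Y i s w) k) \<in> measurable M (count_space UNIV)"
proof (induction k)
  case 0
  show ?case by simp
next
  case (Suc k)
  have [measurable]: "(\<lambda>w. empirical_mean (\<lambda>i s. Y i s w) 1 s) \<in> borel_measurable M"
      "(\<lambda>w. empirical_mean (\<lambda>i s. Y i s w) 2 s) \<in> borel_measurable M" for s
    using assms by (auto intro!: measurable_empirical_mean)
  show ?case
    unfolding two_armed_history.simps Let_def
    \<comment> \<open>There are only countably many histories, so one may be fixed at a time; the
      pull counts are then constants instead of random indices.\<close>
    by (rule measurable_compose_countable [OF _ Suc.IH]) (unfold leads_def, measurable)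
qed

lemma measurable_two_armed_policy:
  assumes "2 \<le> K"
  shows "(\<lambda>w. two_armed_policy \<Delta> (\<lambda>i s. Y i s w) t) \<in> measurable M (count_space UNIV)"
  unfolding two_armed_policy_def
  by (rule measurable_compose [OF measurable_two_armed_history [OF assms]]) simp

text \<open>Independence turns the moment generating function of the sum into a product. Staying in
  \<open>ennreal\<close> avoids integrability arguments.\<close>

lemma nn_integral_exp_sum_rewards_le:
  assumes i: "i \<in> {1..K}" and sg: "sub_gaussian (\<nu> i)"
  shows "(\<integral>\<^sup>+w. ennreal (exp (l * (\<Sum>k=1..s. Y i k w - mean (\<nu> i)))) \<partial>M)
    \<le> ennreal (exp (real s * (l\<^sup>2 / 2)))"
proof -
  let ?Z = "\<lambda>k w. ennreal (exp (l * (Y i k w - mean (\<nu> i))))"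
  let ?J = "Pair i ` {1..s}"
  have "indep_vars (\<lambda>_. borel) (\<lambda>(i, s). Y i s) ?J"
    using i by (intro indep_vars_subset [OF reward_indep]) auto
  then have ind: "indep_vars (\<lambda>_. borel)
      (\<lambda>p w. ennreal (exp (l * ((case p of (i, s) \<Rightarrow> Y i s) w - mean (\<nu> i))))) ?J"
    by (rule indep_vars_compose2 [where Y = "\<lambda>_ x. ennreal (exp (l * (x - mean (\<nu> i))))"]) auto
  have one: "(\<integral>\<^sup>+w. ?Z k w \<partial>M) \<le> ennreal (exp (l\<^sup>2 / 2))" if "k \<in> {1..s}" for k
  proof -
    have "(\<integral>\<^sup>+w. ?Z k w \<partial>M) = (\<integral>\<^sup>+x. ennreal (exp (l * (x - mean (\<nu> i)))) \<partial>distr M borel (Y i k))"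
      using i that by (subst nn_integral_distr) (auto intro!: measurable_reward)
    then show ?thesis
      using reward_distr [OF i, of k] that sg by (simp add: sub_gaussian_def)
  qed
  have "(\<integral>\<^sup>+w. ennreal (exp (l * (\<Sum>k=1..s. Y i k w - mean (\<nu> i)))) \<partial>M)
      = (\<integral>\<^sup>+w. (\<Prod>k=1..s. ?Z k w) \<partial>M)"
    by (simp add: sum_distrib_left exp_sum prod_ennreal)
  also have "\<dots> = (\<Prod>k=1..s. \<integral>\<^sup>+w. ?Z k w \<partial>M)"
    using indep_vars_nn_integral [OF _ ind] by (simp add: prod.reindex inj_on_def)
  also have "\<dots> \<le> (\<Prod>k=1..s. ennreal (exp (l\<^sup>2 / 2)))"
    using one by (intro prod_mono_ennreal) auto
  also have "\<dots> = ennreal (exp (real s * (l\<^sup>2 / 2)))"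
    by (simp only: prod_constant card_atLeastAtMost ennreal_power exp_ge_zero exp_of_nat_mult) simp
  finally show ?thesis .
qed

text \<open>The sign \<open>c\<close> treats both tails at once: the upper one is used for the
  suboptimal arm, the lower one for the optimal arm.\<close>

lemma prob_empirical_mean_deviation_le:
  assumes i: "i \<in> {1..K}" and sg: "sub_gaussian (\<nu> i)" and "1 \<le> s" "0 < \<epsilon>" and c: "\<bar>c\<bar> = 1"
  shows "prob {w \<in> space M. c * (empirical_mean (\<lambda>i s. Y i s w) i s - mean (\<nu> i)) \<ge> \<epsilon>}
    \<le> exp (- (\<epsilon>\<^sup>2 / 2) * real s)"
proof -
  let ?X = "\<lambda>w. c * (\<Sum>k=1..s. Y i k w - mean (\<nu> i))"
  have "c\<^sup>2 = 1" using c by (metis power2_abs one_power2)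
  then have sq: "(\<epsilon> * c)\<^sup>2 = \<epsilon>\<^sup>2" by (simp add: power_mult_distrib)
  have meas: "?X \<in> borel_measurable M"
    using i by (intro borel_measurable_times borel_measurable_sum borel_measurable_diff
        measurable_reward) auto
  have eq: "?X w = real s * (c * (empirical_mean (\<lambda>i s. Y i s w) i s - mean (\<nu> i)))" for w
    using \<open>1 \<le> s\<close> by (simp add: empirical_mean_def sum_subtractf field_simps)
  have "emeasure M {w \<in> space M. c * (empirical_mean (\<lambda>i s. Y i s w) i s - mean (\<nu> i)) \<ge> \<epsilon>}
      = emeasure M {w \<in> space M. ?X w \<ge> real s * \<epsilon>}"
    unfolding eq using \<open>1 \<le> s\<close> by simp
  \<comment> \<open>The Chernoff parameter \<open>l = \<epsilon>\<close> minimises the exponent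
    \<open>- l * s * \<epsilon> + s * l\<^sup>2 / 2\<close>.\<close>
  also have "\<dots> \<le> ennreal (exp (- \<epsilon> * (real s * \<epsilon>))) * (\<integral>\<^sup>+w. ennreal (exp (\<epsilon> * ?X w)) \<partial>M)"
    using Chernoff_ineq_nn_integral_ge [OF \<open>0 < \<epsilon>\<close>, of "space M" M ?X "real s * \<epsilon>"] meas
    by simp
  also have "\<dots> \<le> ennreal (exp (- \<epsilon> * (real s * \<epsilon>))) * ennreal (exp (real s * (\<epsilon>\<^sup>2 / 2)))"
    using nn_integral_exp_sum_rewards_le [OF i sg, of "\<epsilon> * c" s]
    by (intro mult_left_mono) (simp_all add: sq mult.assoc)
  also have "\<dots> = ennreal (exp (- (\<epsilon>\<^sup>2 / 2) * real s))"
    by (simp add: power2_eq_square algebra_simps flip: ennreal_mult' exp_add)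
  finally show ?thesis
    by (simp add: emeasure_eq_measure)
qed

end

theorem theorem1:
  fixes M :: "'w measure" and \<nu> :: "nat \<Rightarrow> real measure"
    and Y :: "nat \<Rightarrow> nat \<Rightarrow> 'w \<Rightarrow> real" and \<Delta> :: real and n :: nat
  assumes "stochastic_bandit M 2 \<nu> Y"
    and "sub_gaussian (\<nu> 1)" and "sub_gaussian (\<nu> 2)"
    and "max (mean (\<nu> 1)) (mean (\<nu> 2)) = 0"
    and "min (mean (\<nu> 1)) (mean (\<nu> 2)) = - \<Delta>"
    and "\<Delta> > 0"
    and "n \<ge> 1"
  shows "regret M 2 \<nu> (\<lambda>t w. two_armed_policy \<Delta> (\<lambda>i s. Y i s w) t) n \<le> \<Delta> + 16 / \<Delta>"
proof -
  interpret stochastic_bandit M 2 \<nu> Y by fact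
  obtain a b :: nat where ab: "{a, b} = {1, 2}" and a0: "mean (\<nu> a) = 0"
    and b0: "mean (\<nu> b) = - \<Delta>"
  proof (cases "mean (\<nu> 1) \<le> mean (\<nu> 2)")
    case True
    with assms(4,5) show ?thesis by (intro that [of 2 1]) auto
  next
    case False
    with assms(4,5) show ?thesis by (intro that [of 1 2]) auto
  qed
  have in12: "a \<in> {1..2}" "b \<in> {1..2}" and neq: "a \<noteq> b"
    using ab by (auto simp: doubleton_eq_iff)
  have sg: "sub_gaussian (\<nu> a)" "sub_gaussian (\<nu> b)"
    using ab assms(2,3) by (auto simp: doubleton_eq_iff)
  define A where "A t w = two_armed_policy \<Delta> (\<lambda>i s. Y i s w) t" for t w
  define \<mu>h where "\<mu>h i s w = empirical_mean (\<lambda>i s. Y i s w) i s" for i s w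
  have [measurable]: "A t \<in> measurable M (count_space UNIV)" for t
    unfolding A_def by (rule measurable_two_armed_policy) simp
  have [measurable]: "\<mu>h a s \<in> borel_measurable M" "\<mu>h b s \<in> borel_measurable M" for s
    unfolding \<mu>h_def using in12 by (auto intro!: measurable_empirical_mean)
  define B where "B s = {w \<in> space M. \<mu>h b s w > - \<Delta> / 2}" for s
  define G where "G s = {w \<in> space M. \<mu>h a s w \<le> - \<Delta> / 2}" for s
  have [measurable]: "B s \<in> sets M" "G s \<in> sets M" for s
    unfolding B_def G_def by measurable
  \<comment> \<open>The threshold lies halfway between the means 0 and \<open>- \<Delta>\<close>, so
    both deviations are \<open>\<Delta> / 2\<close> and share the rate
    \<open>\<Delta>\<^sup>2 / 8\<close>.\<close>
  have chernoff: "exp (- ((\<Delta> / 2)\<^sup>2 / 2) * real s) = exp (- (\<Delta>\<^sup>2 / 8) * real s)" for s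
    by (simp add: power_divide)
  have B: "prob (B s) \<le> exp (- (\<Delta>\<^sup>2 / 8) * real s)" if "1 \<le> s" for s
  proof -
    have "prob (B s) \<le> prob {w \<in> space M. 1 * (\<mu>h b s w - mean (\<nu> b)) \<ge> \<Delta> / 2}"
      unfolding B_def by (intro finite_measure_mono) (auto simp: b0)
    then show ?thesis
      using prob_empirical_mean_deviation_le [OF in12(2) sg(2) that, of "\<Delta> / 2" 1] \<open>\<Delta> > 0\<close>
      unfolding chernoff \<mu>h_def by simp
  qed
  have G: "prob (G s) \<le> exp (- (\<Delta>\<^sup>2 / 8) * real s)" if "1 \<le> s" for s
  proof -
    have "prob (G s) \<le> prob {w \<in> space M. - 1 * (\<mu>h a s w - mean (\<nu> a)) \<ge> \<Delta> / 2}"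
      unfolding G_def by (intro finite_measure_mono) (auto simp: a0)
    then show ?thesis
      using prob_empirical_mean_deviation_le [OF in12(1) sg(1) that, of "\<Delta> / 2" "-1"] \<open>\<Delta> > 0\<close>
      unfolding chernoff \<mu>h_def by simp
  qed
  have pulls: "(\<Sum>t=1..n. indicator {w. A t w = b} w :: real)
      \<le> 1 + (\<Sum>s=1..n. indicator (B s) w) + (\<Sum>s=1..n. indicator (G s) w)"
    if w: "w \<in> space M" for w
  proof -
    let ?y = "\<lambda>i s. Y i s w"
    let ?h = "two_armed_history \<Delta> ?y n"
    have sum_card: "(\<Sum>t=1..n. indicator {w. P t w} w :: real) = card {t \<in> {1..n}. P t w}" for P
      by (simp add: indicator_def sum.If_cases Int_def)
    have "card {t \<in> {1..n}. A t w = b} \<le> count_list ?h b"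
      unfolding A_def by (rule card_two_armed_policy_le)
    also have "\<dots> \<le> 1
      + card {s \<in> {1..<count_list ?h b}. empirical_mean ?y b s > - \<Delta> / 2}
      + card {s \<in> {1..<count_list ?h a}. empirical_mean ?y a s \<le> - \<Delta> / 2}"
      by (rule count_list_two_armed_history_charge [OF ab])
    \<comment> \<open>Replacing the random ranges by the fixed range up to \<open>n\<close> lets
      expectations be taken term by term.\<close>
    also have "\<dots> \<le> 1 + card {s \<in> {1..n}. \<mu>h b s w > - \<Delta> / 2}
        + card {s \<in> {1..n}. \<mu>h a s w \<le> - \<Delta> / 2}"
      using count_list_two_armed_history_le [of \<Delta> ?y n a]
        count_list_two_armed_history_le [of \<Delta> ?y n b]
      by (intro add_mono card_mono) (auto simp: \<mu>h_def)
    finally have "real (card {t \<in> {1..n}. A t w = b})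
      \<le> real (1 + card {s \<in> {1..n}. \<mu>h b s w > - \<Delta> / 2} + card {s \<in> {1..n}. \<mu>h a s w \<le> - \<Delta> / 2})"
      by (rule of_nat_mono)
    then show ?thesis
      using w sum_card [of "\<lambda>t w. A t w = b"] sum_card [of "\<lambda>s w. w \<in> B s"]
        sum_card [of "\<lambda>s w. w \<in> G s"]
      by (simp add: B_def G_def)
  qed
  \<comment> \<open>With optimal mean 0, this makes the regret \<open>\<Delta>\<close> times the
    expected number of pulls of \<open>b\<close>.\<close>
  have mean_A: "mean (\<nu> (A t w)) = - \<Delta> * indicator {w. A t w = b} w" if "1 \<le> t" for t w
    using two_armed_policy_in [OF that, of \<Delta> "\<lambda>i s. Y i s w"] ab a0 b0
    by (auto simp: A_def indicator_def doubleton_eq_iff)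
  have int: "integrable M (\<lambda>w. indicator {w. A t w = b} w :: real)" for t
    by (rule integrable_const_bound [of _ 1]) (auto simp: indicator_def)
  have "(\<Sum>t=1..n. LINT w|M. mean (\<nu> (A t w)))
      = (\<Sum>t=1..n. LINT w|M. - \<Delta> * indicator {w. A t w = b} w)"
    by (intro sum.cong Bochner_Integration.integral_cong mean_A) auto
  moreover have "Max ((\<lambda>i. mean (\<nu> i)) ` {1..2}) = 0"
    using assms(4) by (simp add: atLeastAtMost_insertL [symmetric] numeral_2_eq_2)
  ultimately have "regret M 2 \<nu> A n
      = - (\<Sum>t=1..n. LINT w|M. - \<Delta> * indicator {w. A t w = b} w)"
    unfolding regret_def by simp
  also have "\<dots> = \<Delta> * (LINT w|M. (\<Sum>t=1..n. indicator {w. A t w = b} w))"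
    using int by (simp add: sum_distrib_left sum_negf)
  also have "\<dots> \<le> \<Delta> * (LINT w|M. 1 + (\<Sum>s=1..n. indicator (B s) w) + (\<Sum>s=1..n. indicator (G s) w))"
    using pulls int \<open>\<Delta> > 0\<close>
    by (intro mult_left_mono integral_mono) (auto simp: emeasure_eq_measure)
  also have "(LINT w|M. 1 + (\<Sum>s=1..n. indicator (B s) w) + (\<Sum>s=1..n. indicator (G s) w))
      = 1 + (\<Sum>s=1..n. prob (B s)) + (\<Sum>s=1..n. prob (G s))"
    by (simp add: emeasure_eq_measure prob_space)
  also have "\<Delta> * (1 + (\<Sum>s=1..n. prob (B s)) + (\<Sum>s=1..n. prob (G s)))
      \<le> \<Delta> * (1 + 1 / (\<Delta>\<^sup>2 / 8) + 1 / (\<Delta>\<^sup>2 / 8))"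
  proof -
    have *: "(\<Sum>s=1..n. f s) \<le> 1 / (\<Delta>\<^sup>2 / 8)"
      if "\<And>s. 1 \<le> s \<Longrightarrow> f s \<le> exp (- (\<Delta>\<^sup>2 / 8) * real s)" for f
    proof (rule order.trans)
      show "(\<Sum>s=1..n. f s) \<le> (\<Sum>s=1..n. exp (- (\<Delta>\<^sup>2 / 8) * real s))"
        by (intro sum_mono that) simp
      show "(\<Sum>s=1..n. exp (- (\<Delta>\<^sup>2 / 8) * real s)) \<le> 1 / (\<Delta>\<^sup>2 / 8)"
        using \<open>\<Delta> > 0\<close> by (intro sum_exp_neg_le) simp
    qed
    show ?thesis
      using \<open>\<Delta> > 0\<close> by (intro mult_left_mono add_mono * B G) auto
  qed
  also have "\<dots> = \<Delta> + 16 / \<Delta>"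
    using \<open>\<Delta> > 0\<close> by (simp add: field_simps power2_eq_square)
  finally show ?thesis
    by (simp add: A_def [abs_def])
qed

end
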